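(* Let $n\ge1$. For any probability matrix $\boldsymbol\Theta_0\in[0,1]^{n\times n}$ (symmetric with zero diagonal), $$\mathbb E_{\boldsymbol\Theta_0}\|\boldsymbol A-\boldsymbol\Theta_0\|_\square\le 12\sqrt{\frac{\|\boldsymbol\Theta_0\|_1+n}{n^3}}.$$ In particular, if $\|\boldsymbol\Theta_0\|_\infty\ge 1/n$, then $$\mathbb E_{\boldsymbol\Theta_0}\|\boldsymbol A-\boldsymbol\Theta_0\|_\square\le 24\sqrt{\frac{\|\boldsymbol\Theta_0\|_\infty}{n}}.$$
   Context: Inhomogeneous random graph model with respect to $\boldsymbol\Theta_0$: $\boldsymbol A$ is a random symmetric $\{0,1\}$-valued $n\times n$ matrix with zero diagonal whose entries $\boldsymbol A_{ij}$, $i<j$, are independent Bernoulli variables with parameters $(\boldsymbol\Theta_0)_{ij}$; $\mathbb E_{\boldsymbol\Theta_0}$ denotes the corresponding expectation. For $\boldsymbol B\in\mathbb R^{n\times n}$: $\|\boldsymbol B\|_\square=\frac1{n^2}\max_{S,T\subset\{1,\dots,n\}}\big|\sum_{i\in S,j\in T}\boldsymbol B_{ij}\big|$ (matrix cut norm), $\|\boldsymbol B\|_1=\sum_{i,j}|\boldsymbol B_{ij}|$, $\|\boldsymbol B\|_\infty=\max_{i,j}|\boldsymbol B_{ij}|$ (entry-wise norms). *)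

theory Defs
  imports "HOL-Probability.Probability"
begin

definition cut_norm :: "real^'n^'n \<Rightarrow> real" where
  "cut_norm B =
     1 / (real CARD('n))\<^sup>2 *
     Max (range (\<lambda>(S, T). \<bar>\<Sum>i\<in>S. \<Sum>j\<in>T. B $ i $ j\<bar>))"

definition entry_norm1 :: "real^'n^'n \<Rightarrow> real" where
  "entry_norm1 B = (\<Sum>i\<in>UNIV. \<Sum>j\<in>UNIV. \<bar>B $ i $ j\<bar>)"

definition entry_norm_inf :: "real^'n^'n \<Rightarrow> real" where
  "entry_norm_inf B = Max (range (\<lambda>(i, j). \<bar>B $ i $ j\<bar>))"

definition probability_matrix :: "real^'n^'n \<Rightarrow> bool" where
  "probability_matrix \<Theta> \<longleftrightarrow>
     (\<forall>i j. \<Theta> $ i $ j \<in> {0..1}) \<and> transpose \<Theta> = \<Theta> \<and> (\<forall>i. \<Theta> $ i $ i = 0)"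

text \<open>
  The vertex set is the index type; its linear order only serves to select one
  representative of each unordered pair of vertices.
  Measurability of the entries above the diagonal is part of \<open>indep_vars\<close>;
  for the other entries it follows from symmetry and the zero diagonal.
\<close>

locale inhomogeneous_random_graph = prob_space M
  for M :: "'w measure"
    and \<Theta> :: "real^'n::{finite,linorder}^'n::{finite,linorder}"
    and A :: "'w \<Rightarrow> real^'n::{finite,linorder}^'n::{finite,linorder}" +
  assumes binary: "\<And>\<omega> i j. \<omega> \<in> space M \<Longrightarrow> A \<omega> $ i $ j \<in> {0, 1}"
    and symmetric: "\<And>\<omega>. \<omega> \<in> space M \<Longrightarrow> transpose (A \<omega>) = A \<omega>"
    and zero_diagonal: "\<And>\<omega> i. \<omega> \<in> space M \<Longrightarrow> A \<omega> $ i $ i = 0"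
    and indep: "indep_vars (\<lambda>_. borel) (\<lambda>(i, j) \<omega>. A \<omega> $ i $ j) {(i, j). i < j}"
    and bernoulli: "\<And>i j. i < j \<Longrightarrow>
      distr M borel (\<lambda>\<omega>. A \<omega> $ i $ j) =
      distr (measure_pmf (bernoulli_pmf (\<Theta> $ i $ j))) borel of_bool"

end

theory Submission
  imports Defs
begin

text \<open>
  For fixed \<open>S\<close>, \<open>T\<close> the sum of \<open>A - \<Theta>\<close> over \<open>S \<times> T\<close> is a combination, with coefficients
  in \<open>{0, 1, 2}\<close>, of the independent centred entries above the diagonal. Its exponential moment at
  \<open>t\<close> with \<open>\<bar>t\<bar> \<le> 1/2\<close> is therefore at most \<open>exp (2 t\<^sup>2 s)\<close>, where \<open>s\<close> is the entry-wise
  1-norm of \<open>\<Theta>\<close>. A union bound over the \<open>2 \<cdot> 4\<^sup>n \<le> exp (3 n)\<close> choices of \<open>S\<close>, \<open>T\<close> and a sign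
  bounds the expected maximum by \<open>3 n / t + 2 t s\<close>, and \<open>t = sqrt (n / (s + n)) / 2\<close> makes this at
  most \<open>7 sqrt (n (s + n))\<close>.
\<close>

section \<open>Exponential bounds for one centred Bernoulli variable\<close>

lemma exp_le_quadratic:
  fixes u :: real
  assumes "\<bar>u\<bar> \<le> 1"
  shows "exp u \<le> 1 + u + u\<^sup>2"
proof (cases "u \<ge> 0")
  case True
  then show ?thesis using exp_bound[of u] assms by simp
next
  case False
  define v where "v = - u"
  have v: "0 \<le> v" using False by (simp add: v_def)
  \<comment> \<open>The odd term of lowest order cancels in this product and every other term beside
    1 is nonnegative. Hence \<open>1 - v + v\<^sup>2\<close> dominates the reciprocal of
    \<open>exp v\<close>.\<close>
  have "1 \<le> (1 + v + v\<^sup>2 / 2) * (1 - v + v\<^sup>2)"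
  proof -
    have "(1 + v + v\<^sup>2 / 2) * (1 - v + v\<^sup>2) = 1 + v\<^sup>2 / 2 + v ^ 3 / 2 + v ^ 4 / 2"
      by (simp add: power2_eq_square power3_eq_cube power4_eq_xxxx field_simps)
    then show ?thesis using v by simp
  qed
  also have "\<dots> \<le> exp v * (1 - v + v\<^sup>2)"
  proof (rule mult_right_mono)
    show "1 + v + v\<^sup>2 / 2 \<le> exp v" using exp_lower_Taylor_quadratic[OF v] by simp
    have "1 - v + v\<^sup>2 = (v - 1 / 2)\<^sup>2 + 3 / 4" by (simp add: power2_eq_square field_simps)
    then show "0 \<le> 1 - v + v\<^sup>2" by simp
  qed
  finally have "exp (- v) \<le> 1 - v + v\<^sup>2"
    by (simp add: exp_minus field_simps)
  then show ?thesis by (simp add: v_def)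
qed

text \<open>Once \<open>exp (- (u * p))\<close> is factored out, \<open>1 + x \<le> exp x\<close>
  applies to the other factor and the terms linear in \<open>u\<close> cancel. Keeping
  \<open>p\<close> in the exponent, rather than a constant as in Hoeffding's lemma, is what makes
  the final bound scale with the 1-norm of \<open>\<Theta>\<close>.\<close>

lemma centred_bernoulli_mgf_le:
  fixes p u :: real
  assumes "0 \<le> p" "\<bar>u\<bar> \<le> 1"
  shows "p * exp (u * (1 - p)) + (1 - p) * exp (- (u * p)) \<le> exp (p * u\<^sup>2)"
proof -
  have "p * exp (u * (1 - p)) + (1 - p) * exp (- (u * p)) = exp (- (u * p)) * (1 + p * (exp u - 1))"
    by (simp add: exp_add[symmetric] algebra_simps)
  also have "\<dots> \<le> exp (- (u * p)) * exp (p * (u + u\<^sup>2))"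
  proof (rule mult_left_mono)
    have "1 + p * (exp u - 1) \<le> 1 + p * (u + u\<^sup>2)"
      using exp_le_quadratic[OF assms(2)] assms(1) by (intro add_left_mono mult_left_mono) auto
    also have "\<dots> \<le> exp (p * (u + u\<^sup>2))" by (rule exp_ge_add_one_self)
    finally show "1 + p * (exp u - 1) \<le> exp (p * (u + u\<^sup>2))" .
  qed simp
  also have "\<dots> = exp (p * u\<^sup>2)"
    by (simp add: exp_add[symmetric] algebra_simps)
  finally show ?thesis .
qed

section \<open>Sums over pairs of vertices, and the matrix norms\<close>

text \<open>Merges each entry with its mirror image, so that a full matrix sum is indexed by the
  pairs \<open>i < j\<close>, on which independence is assumed.\<close>

lemma sum_sum_eq_sum_less:
  fixes f :: "'n::{finite,linorder} \<Rightarrow> 'n \<Rightarrow> 'a::comm_monoid_add"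
  assumes "\<And>i. f i i = 0"
  shows "(\<Sum>i\<in>UNIV. \<Sum>j\<in>UNIV. f i j) = (\<Sum>(i, j)\<in>{(i, j). i < j}. f i j + f j i)"
proof -
  have "(\<Sum>i\<in>UNIV. \<Sum>j\<in>UNIV. f i j) = (\<Sum>(i, j)\<in>UNIV. f i j)"
    by (simp add: sum.cartesian_product)
  also have "\<dots> = (\<Sum>(i, j)\<in>{(i, j). i < j} \<union> {(i, j). j < i}. f i j)"
    by (rule sum.mono_neutral_right) (auto simp: assms not_less_iff_gr_or_eq)
  also have "\<dots> = (\<Sum>(i, j)\<in>{(i, j). i < j}. f i j) + (\<Sum>(i, j)\<in>{(i, j). j < i}. f i j)"
    by (rule sum.union_disjoint) auto
  also have "(\<Sum>(i, j)\<in>{(i, j). j < i}. f i j) = (\<Sum>(i, j)\<in>{(i, j). i < j}. f j i)"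
    by (rule sum.reindex_bij_witness[of _ prod.swap prod.swap]) auto
  finally show ?thesis
    unfolding case_prod_unfold sum.distrib .
qed

lemma entry_norm1_eq_sum_less:
  fixes \<Theta> :: "real^'n::{finite,linorder}^'n::{finite,linorder}"
  assumes "probability_matrix \<Theta>"
  shows "entry_norm1 \<Theta> = 2 * (\<Sum>(i, j)\<in>{(i, j). i < j}. \<Theta> $ i $ j)"
proof -
  have sym: "\<Theta> $ i $ j = \<Theta> $ j $ i" for i j
    using assms unfolding probability_matrix_def by (metis transpose_def vec_lambda_beta)
  have nonneg: "\<bar>\<Theta> $ i $ j\<bar> = \<Theta> $ i $ j" for i j
    using assms by (simp add: probability_matrix_def)
  show ?thesis
    unfolding entry_norm1_def nonneg
    by (subst sum_sum_eq_sum_less)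
      (use assms in \<open>auto simp: probability_matrix_def sum_distrib_left sym intro!: sum.cong\<close>)
qed

lemma entry_norm1_le_entry_norm_inf:
  "entry_norm1 (B :: real^'n^'n) \<le> real CARD('n) ^ 2 * entry_norm_inf B"
proof -
  have "\<bar>B $ i $ j\<bar> \<le> entry_norm_inf B" for i j
    unfolding entry_norm_inf_def by (rule Max_ge) auto
  then have "entry_norm1 B \<le> (\<Sum>i\<in>(UNIV::'n set). \<Sum>j\<in>(UNIV::'n set). entry_norm_inf B)"
    unfolding entry_norm1_def by (intro sum_mono)
  then show ?thesis by (simp add: power2_eq_square algebra_simps)
qed

lemma cut_norm_attained:
  fixes B :: "real^'n^'n"
  obtains S T where "real CARD('n) ^ 2 * cut_norm B = \<bar>\<Sum>i\<in>S. \<Sum>j\<in>T. B $ i $ j\<bar>"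
proof -
  have "Max (range (\<lambda>(S, T). \<bar>\<Sum>i\<in>S. \<Sum>j\<in>T. B $ i $ j\<bar>))
      \<in> range (\<lambda>(S, T). \<bar>\<Sum>i\<in>S. \<Sum>j\<in>T. B $ i $ j\<bar>)"
    by (rule Max_in) auto
  then show ?thesis using that by (force simp: cut_norm_def)
qed

section \<open>Exponential moments of block sums\<close>

context inhomogeneous_random_graph
begin

lemma entry_measurable:
  assumes "i < j"
  shows "(\<lambda>\<omega>. A \<omega> $ i $ j) \<in> borel_measurable M"
  using indep assms by (auto simp: indep_vars_def)

lemma expectation_entry:
  fixes g :: "real \<Rightarrow> real"
  assumes "i < j" "\<Theta> $ i $ j \<in> {0..1}" and [measurable]: "g \<in> borel_measurable borel"
  shows "expectation (\<lambda>\<omega>. g (A \<omega> $ i $ j)) = \<Theta> $ i $ j * g 1 + (1 - \<Theta> $ i $ j) * g 0"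
proof -
  have "expectation (\<lambda>\<omega>. g (A \<omega> $ i $ j)) = integral\<^sup>L (distr M borel (\<lambda>\<omega>. A \<omega> $ i $ j)) g"
    by (rule integral_distr[symmetric]) (use entry_measurable assms in auto)
  also have "\<dots> = (\<integral>b. g (of_bool b) \<partial>measure_pmf (bernoulli_pmf (\<Theta> $ i $ j)))"
    unfolding bernoulli[OF assms(1)] by (rule integral_distr) auto
  also have "\<dots> = \<Theta> $ i $ j * g 1 + (1 - \<Theta> $ i $ j) * g 0"
    using assms(2) by simp
  finally show ?thesis .
qed

text \<open>Independence turns the exponential moment into a product over \<open>i < j\<close>. The
  bound on \<open>t\<close> keeps \<open>t * c i j\<close> in \<open>[-1, 1]\<close>, as the
  one-variable estimate requires.\<close>

lemma
  fixes t :: real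
  assumes \<Theta>: "probability_matrix \<Theta>" and t: "\<bar>t\<bar> \<le> 1 / 2"
  shows integrable_exp_block_sum:
      "integrable M (\<lambda>\<omega>. exp (t * (\<Sum>i\<in>S. \<Sum>j\<in>T. (A \<omega> - \<Theta>) $ i $ j)))" (is ?int)
    and expectation_exp_block_sum_le:
      "expectation (\<lambda>\<omega>. exp (t * (\<Sum>i\<in>S. \<Sum>j\<in>T. (A \<omega> - \<Theta>) $ i $ j)))
        \<le> exp (2 * t\<^sup>2 * entry_norm1 \<Theta>)" (is ?le)
proof -
  \<comment> \<open>Counts how many of the ordered pairs \<open>(i, j)\<close> and
    \<open>(j, i)\<close> lie in \<open>S \<times> T\<close>.\<close>
  define c :: "'n \<Rightarrow> 'n \<Rightarrow> real"
    where "c i j = of_bool (i \<in> S \<and> j \<in> T) + of_bool (j \<in> S \<and> i \<in> T)" for i j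
  define E :: "'n \<times> 'n \<Rightarrow> 'w \<Rightarrow> real"
    where "E = (\<lambda>(i, j) \<omega>. exp (t * c i j * (A \<omega> $ i $ j - \<Theta> $ i $ j)))"
  let ?P = "{(i, j). i < j} :: ('n \<times> 'n) set"
  have \<Theta>01: "\<Theta> $ i $ j \<in> {0..1}" for i j
    using \<Theta> by (simp add: probability_matrix_def)
  have \<Theta>sym: "\<Theta> $ i $ j = \<Theta> $ j $ i" for i j
    using \<Theta> unfolding probability_matrix_def by (metis transpose_def vec_lambda_beta)
  have ex: "exp (t * (\<Sum>i\<in>S. \<Sum>j\<in>T. (A \<omega> - \<Theta>) $ i $ j)) = (\<Prod>p\<in>?P. E p \<omega>)"
    if \<omega>: "\<omega> \<in> space M" for \<omega>
  proof -
    have Asym: "A \<omega> $ i $ j = A \<omega> $ j $ i" for i j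
      using symmetric[OF \<omega>] by (metis transpose_def vec_lambda_beta)
    have "(\<Sum>i\<in>S. \<Sum>j\<in>T. (A \<omega> - \<Theta>) $ i $ j)
        = (\<Sum>(i, j)\<in>S \<times> T. (A \<omega> - \<Theta>) $ i $ j)"
      by (rule sum.cartesian_product)
    also have "\<dots> = (\<Sum>(i, j)\<in>UNIV \<times> UNIV. of_bool (i \<in> S \<and> j \<in> T) * (A \<omega> - \<Theta>) $ i $ j)"
      by (rule sum.mono_neutral_cong_left) auto
    also have "\<dots> = (\<Sum>i\<in>UNIV. \<Sum>j\<in>UNIV. of_bool (i \<in> S \<and> j \<in> T) * (A \<omega> - \<Theta>) $ i $ j)"
      by (rule sum.cartesian_product[symmetric])
    also have "\<dots> = (\<Sum>(i, j)\<in>?P. c i j * (A \<omega> $ i $ j - \<Theta> $ i $ j))"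
      by (subst sum_sum_eq_sum_less)
        (use zero_diagonal[OF \<omega>] \<Theta> Asym \<Theta>sym in
          \<open>auto simp: probability_matrix_def c_def algebra_simps intro!: sum.cong\<close>)
    finally show ?thesis
      by (simp add: E_def sum_distrib_left exp_sum split_beta mult.assoc)
  qed
  have indepE: "indep_vars (\<lambda>_. borel) E ?P"
  proof -
    have "indep_vars (\<lambda>_. borel)
        (\<lambda>p \<omega>. (\<lambda>x. exp (t * c (fst p) (snd p) * (x - \<Theta> $ fst p $ snd p)))
          ((\<lambda>(i, j) \<omega>. A \<omega> $ i $ j) p \<omega>)) ?P"
      by (rule indep_vars_compose2[OF indep]) measurable
    then show ?thesis unfolding E_def case_prod_unfold .
  qed
  have intE: "integrable M (E p)" if p_in: "p \<in> ?P" for p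
  proof -
    obtain i j where p: "p = (i, j)" "i < j" using p_in by auto
    note [measurable] = entry_measurable[OF p(2)]
    show ?thesis unfolding E_def p(1) prod.case
    proof (rule integrable_const_bound)
      show "AE \<omega> in M. norm (exp (t * c i j * (A \<omega> $ i $ j - \<Theta> $ i $ j))) \<le> exp 1"
      proof (rule AE_I2)
        fix \<omega> assume "\<omega> \<in> space M"
        then have "\<bar>A \<omega> $ i $ j - \<Theta> $ i $ j\<bar> \<le> 1"
          using binary[of \<omega> i j] \<Theta>01[of i j] by auto
        moreover have "\<bar>t * c i j\<bar> \<le> 1"
          using t by (auto simp: c_def of_bool_def)
        ultimately have "\<bar>t * c i j * (A \<omega> $ i $ j - \<Theta> $ i $ j)\<bar> \<le> 1"
          by (subst abs_mult) (intro mult_le_one, auto)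
        then show "norm (exp (t * c i j * (A \<omega> $ i $ j - \<Theta> $ i $ j))) \<le> exp 1" by simp
      qed
    qed measurable
  qed
  have fin: "finite ?P" by simp
  show ?int
    using indep_vars_integrable[OF fin indepE intE] ex
    by (subst Bochner_Integration.integrable_cong[OF refl ex]) auto
  have "expectation (\<lambda>\<omega>. exp (t * (\<Sum>i\<in>S. \<Sum>j\<in>T. (A \<omega> - \<Theta>) $ i $ j)))
      = expectation (\<lambda>\<omega>. \<Prod>p\<in>?P. E p \<omega>)"
    by (rule Bochner_Integration.integral_cong[OF refl ex])
  also have "\<dots> = (\<Prod>p\<in>?P. expectation (E p))"
    by (rule indep_vars_lebesgue_integral[OF fin indepE intE])
  also have "\<dots> \<le> (\<Prod>(i, j)\<in>?P. exp (4 * t\<^sup>2 * \<Theta> $ i $ j))"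
  proof (rule prod_mono, clarify)
    fix i j :: 'n assume "i < j"
    have "expectation (E (i, j)) = \<Theta> $ i $ j * exp (t * c i j * (1 - \<Theta> $ i $ j))
        + (1 - \<Theta> $ i $ j) * exp (- (t * c i j * \<Theta> $ i $ j))"
      unfolding E_def prod.case
      by (subst expectation_entry[OF \<open>i < j\<close> \<Theta>01]) auto
    also have "\<dots> \<le> exp (\<Theta> $ i $ j * (t * c i j)\<^sup>2)"
      using \<Theta>01[of i j] t
      by (intro centred_bernoulli_mgf_le) (auto simp: c_def of_bool_def)
    \<comment> \<open>The 4 is the square of the largest coefficient 2.\<close>
    also have "\<dots> \<le> exp (4 * t\<^sup>2 * \<Theta> $ i $ j)"
    proof -
      have "(t * c i j)\<^sup>2 \<le> 4 * t\<^sup>2"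
        by (auto simp: c_def of_bool_def power_mult_distrib)
      from mult_left_mono[OF this, of "\<Theta> $ i $ j"] show ?thesis
        using \<Theta>01[of i j] by (simp add: mult.commute)
    qed
    finally show "0 \<le> expectation (E (i, j)) \<and> expectation (E (i, j)) \<le> exp (4 * t\<^sup>2 * \<Theta> $ i $ j)"
      by (simp add: E_def)
  qed
  \<comment> \<open>The entries above the diagonal carry half of the 1-norm, which turns 4 into
    2.\<close>
  also have "\<dots> = exp (2 * t\<^sup>2 * entry_norm1 \<Theta>)"
    by (simp add: entry_norm1_eq_sum_less[OF \<Theta>] sum_distrib_left exp_sum split_beta mult.assoc
        mult.left_commute)
  finally show ?le .
qed

section \<open>Expected maximum over all blocks, for a free parameter \<open>t\<close>\<close>

lemma expectation_cut_norm_le: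
  fixes t :: real
  assumes \<Theta>: "probability_matrix \<Theta>" and t: "0 < t" "t \<le> 1 / 2"
  shows "real CARD('n) ^ 2 * expectation (\<lambda>\<omega>. cut_norm (A \<omega> - \<Theta>))
    \<le> 3 * real CARD('n) / t + 2 * t * entry_norm1 \<Theta>"
proof -
  define n where "n = real CARD('n)"
  define s where "s = entry_norm1 \<Theta>"
  \<comment> \<open>Logarithm of the bound on the expectation of \<open>F\<close>:
    \<open>3 * n\<close> pays for the number of summands, the rest for the size of each.\<close>
  define c where "c = 3 * n + 2 * t\<^sup>2 * s"
  define X where "X = (\<lambda>(S, T) \<omega>. \<Sum>i\<in>S. \<Sum>j\<in>T. (A \<omega> - \<Theta>) $ i $ j)"
  \<comment> \<open>Summing over all blocks and both signs dominates
    \<open>exp (t * \<bar>X q \<omega>\<bar>)\<close> for whichever block \<open>q\<close> attains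
    the maximum at \<open>\<omega>\<close>.\<close>
  define F where "F \<omega> = (\<Sum>q\<in>UNIV. exp (t * X q \<omega>) + exp (- t * X q \<omega>))" for \<omega>
  \<comment> \<open>The parameter \<open>r\<close> is general because both \<open>t\<close> and
    \<open>- t\<close> are substituted for it.\<close>
  have int: "integrable M (\<lambda>\<omega>. exp (r * X q \<omega>))" if "\<bar>r\<bar> \<le> 1 / 2" for r q
    using integrable_exp_block_sum[OF \<Theta> that, where S = "fst q" and T = "snd q"] by (simp add: X_def split_beta)
  have le: "expectation (\<lambda>\<omega>. exp (r * X q \<omega>)) \<le> exp (2 * t\<^sup>2 * s)"
    if "\<bar>r\<bar> \<le> 1 / 2" "r\<^sup>2 = t\<^sup>2" for r q
    using expectation_exp_block_sum_le[OF \<Theta> that(1), where S = "fst q" and T = "snd q"] that(2)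
    by (simp add: X_def split_beta s_def)
  have intF: "integrable M F"
    unfolding F_def using t by (intro Bochner_Integration.integrable_sum
        Bochner_Integration.integrable_add int) auto
  \<comment> \<open>There are \<open>4 ^ CARD('n)\<close> blocks; the factor 2 for the sign is
    absorbed into \<open>2 ^ CARD('n)\<close>, and \<open>8 \<le> exp 3\<close> follows from
    \<open>2 \<le> exp 1\<close>.\<close>
  have card: "real CARD('n set \<times> 'n set) * 2 \<le> exp (3 * n)"
  proof -
    have n1: "1 \<le> CARD('n)" by (simp add: Suc_leI)
    have "real CARD('n set \<times> 'n set) * 2 = 4 ^ CARD('n) * 2"
      by (simp add: card_Pow power_mult_distrib[symmetric] flip: Pow_UNIV UNIV_Times_UNIV)
    also have "\<dots> \<le> 4 ^ CARD('n) * 2 ^ CARD('n)"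
      using power_increasing[OF n1, of "2::real"] by (intro mult_left_mono) auto
    also have "\<dots> = 8 ^ CARD('n)" by (simp add: power_mult_distrib[symmetric])
    also have "\<dots> \<le> exp 3 ^ CARD('n)"
    proof (rule power_mono)
      have "(2::real) \<le> exp 1" using exp_ge_add_one_self[of 1] by simp
      then have "(2::real) ^ 3 \<le> exp 1 ^ 3" by (rule power_mono) simp
      then show "(8::real) \<le> exp 3" by (simp add: exp_of_nat_mult[symmetric])
    qed simp
    also have "\<dots> = exp (3 * n)" by (simp add: n_def exp_of_nat_mult[symmetric] mult.commute)
    finally show ?thesis .
  qed
  have "expectation F = (\<Sum>q\<in>UNIV. expectation (\<lambda>\<omega>. exp (t * X q \<omega>) + exp (- t * X q \<omega>)))"
    unfolding F_def using t
    by (intro Bochner_Integration.integral_sum Bochner_Integration.integrable_add int) auto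
  also have "\<dots> = (\<Sum>q\<in>UNIV. expectation (\<lambda>\<omega>. exp (t * X q \<omega>))
      + expectation (\<lambda>\<omega>. exp (- t * X q \<omega>)))"
    using t by (intro sum.cong refl Bochner_Integration.integral_add int) auto
  also have "\<dots> \<le> (\<Sum>q\<in>(UNIV::('n set \<times> 'n set) set). exp (2 * t\<^sup>2 * s) + exp (2 * t\<^sup>2 * s))"
    using t by (intro sum_mono add_mono le) auto
  also have "\<dots> = real CARD('n set \<times> 'n set) * 2 * exp (2 * t\<^sup>2 * s)" by simp
  also have "\<dots> \<le> exp (3 * n) * exp (2 * t\<^sup>2 * s)" by (rule mult_right_mono[OF card]) simp
  also have "\<dots> = exp c" by (simp add: c_def exp_add)
  finally have EF: "expectation F \<le> exp c" .
  \<comment> \<open>The tangent of the exponential at \<open>c\<close> replaces Jensen's inequality for the logarithm.\<close>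
  have pw: "0 \<le> t * (n\<^sup>2 * cut_norm (A \<omega> - \<Theta>)) \<and>
      t * (n\<^sup>2 * cut_norm (A \<omega> - \<Theta>)) \<le> c - 1 + exp (- c) * F \<omega>" for \<omega>
  proof -
    obtain S T where "n\<^sup>2 * cut_norm (A \<omega> - \<Theta>) = \<bar>\<Sum>i\<in>S. \<Sum>j\<in>T. (A \<omega> - \<Theta>) $ i $ j\<bar>"
      using cut_norm_attained[of "A \<omega> - \<Theta>"] unfolding n_def by blast
    then have eq: "n\<^sup>2 * cut_norm (A \<omega> - \<Theta>) = \<bar>X (S, T) \<omega>\<bar>" by (simp add: X_def)
    have "t * \<bar>X (S, T) \<omega>\<bar> \<le> c - 1 + exp (t * \<bar>X (S, T) \<omega>\<bar> - c)"
      using exp_ge_add_one_self[of "t * \<bar>X (S, T) \<omega>\<bar> - c"] by linarith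
    also have "exp (t * \<bar>X (S, T) \<omega>\<bar> - c) = exp (- c) * exp (t * \<bar>X (S, T) \<omega>\<bar>)"
      by (simp add: exp_add[symmetric])
    also have "exp (t * \<bar>X (S, T) \<omega>\<bar>) \<le> exp (t * X (S, T) \<omega>) + exp (- t * X (S, T) \<omega>)"
      by (auto simp: abs_if)
    also have "\<dots> \<le> F \<omega>"
      unfolding F_def
      by (rule member_le_sum[where f = "\<lambda>q. exp (t * X q \<omega>) + exp (- t * X q \<omega>)"]) auto
    finally show ?thesis using eq t by simp
  qed
  have "t * (n\<^sup>2 * expectation (\<lambda>\<omega>. cut_norm (A \<omega> - \<Theta>)))
      = expectation (\<lambda>\<omega>. t * (n\<^sup>2 * cut_norm (A \<omega> - \<Theta>)))" by simp
  also have "\<dots> \<le> expectation (\<lambda>\<omega>. c - 1 + exp (- c) * F \<omega>)"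
  \<comment> \<open>Only the upper bound is shown to be integrable. If the left side were not, its
    integral would be 0 by default, which the nonnegativity of the right side covers.\<close>
  proof (rule integral_mono')
    show "integrable M (\<lambda>\<omega>. c - 1 + exp (- c) * F \<omega>)" using intF by simp
    show "t * (n\<^sup>2 * cut_norm (A \<omega> - \<Theta>)) \<le> c - 1 + exp (- c) * F \<omega>" for \<omega>
      using pw by blast
    show "0 \<le> c - 1 + exp (- c) * F \<omega>" for \<omega>
      using pw[of \<omega>] by linarith
  qed
  also have "\<dots> = c - 1 + exp (- c) * expectation F"
    using intF prob_space by simp
  \<comment> \<open>With the tangent taken at \<open>c\<close>, the last term is at most 1 and
    cancels the \<open>- 1\<close>.\<close>
  also have "\<dots> \<le> c - 1 + exp (- c) * exp c"
    using EF by simp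
  also have "\<dots> = c" by (simp add: exp_add[symmetric])
  finally have "n\<^sup>2 * expectation (\<lambda>\<omega>. cut_norm (A \<omega> - \<Theta>)) \<le> c / t"
    using t by (simp add: field_simps)
  also have "c / t = 3 * n / t + 2 * t * s"
    using t by (simp add: c_def field_simps power2_eq_square)
  finally show ?thesis by (simp add: n_def s_def)
qed

end

section \<open>Choice of \<open>t\<close> and the passage to the two stated bounds\<close>

theorem proposition2:
  fixes M :: "'w measure"
    and \<Theta> :: "real^'n::{finite,linorder}^'n::{finite,linorder}"
    and A :: "'w \<Rightarrow> real^'n::{finite,linorder}^'n::{finite,linorder}"
  assumes "probability_matrix \<Theta>"
    and "inhomogeneous_random_graph M \<Theta> A"
  shows "prob_space.expectation M (\<lambda>\<omega>. cut_norm (A \<omega> - \<Theta>))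
           \<le> 12 * sqrt ((entry_norm1 \<Theta> + real CARD('n)) / real CARD('n) ^ 3) \<and>
         (entry_norm_inf \<Theta> \<ge> 1 / real CARD('n) \<longrightarrow>
         prob_space.expectation M (\<lambda>\<omega>. cut_norm (A \<omega> - \<Theta>))
           \<le> 24 * sqrt (entry_norm_inf \<Theta> / real CARD('n)))"
proof -
  interpret inhomogeneous_random_graph M \<Theta> A by (rule assms(2))
  define n where "n = real CARD('n)"
  define s where "s = entry_norm1 \<Theta>"
  define m where "m = entry_norm_inf \<Theta>"
  \<comment> \<open>Balances \<open>3 * n / t\<close> against \<open>2 * t * s\<close> up to
    constants. The summand \<open>n\<close> in the denominator keeps the root at most 1, so
    \<open>t \<le> 1 / 2\<close> even for small \<open>s\<close>.\<close>
  define t where "t = sqrt (n / (s + n)) / 2"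
  define x where "x = expectation (\<lambda>\<omega>. cut_norm (A \<omega> - \<Theta>))"
  define y where "y = sqrt (n * (s + n))"
  have n: "0 < n" by (simp add: n_def)
  have s: "0 \<le> s" by (simp add: s_def entry_norm1_def sum_nonneg)
  have t: "0 < t" "t \<le> 1 / 2" using n s by (simp_all add: t_def)
  have "n / t = 2 * y"
  proof -
    have "y * (2 * t) = n"
      using n s by (simp add: y_def t_def real_sqrt_mult[symmetric])
    then show ?thesis using t by (simp add: field_simps)
  qed
  moreover have "2 * t * s \<le> y"
  proof -
    have "2 * t * s \<le> 2 * t * (s + n)" using t n by simp
    also have "\<dots> = y"
    proof -
      have "sqrt (n / (s + n)) * sqrt ((s + n)\<^sup>2) = y"
        unfolding y_def real_sqrt_mult[symmetric] using n s
        by (simp add: power2_eq_square)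
      then show ?thesis using n s by (simp add: t_def)
    qed
    finally show ?thesis .
  qed
  moreover have "n\<^sup>2 * x \<le> 3 * n / t + 2 * t * s"
    using expectation_cut_norm_le[OF assms(1) t] by (simp add: n_def s_def x_def)
  \<comment> \<open>The first term equals \<open>6 * y\<close> and the second is at most
    \<open>y\<close>.\<close>
  ultimately have "n\<^sup>2 * x \<le> 7 * y" by simp
  also have "y = n\<^sup>2 * sqrt ((s + n) / n ^ 3)"
  proof -
    have "n\<^sup>2 * sqrt ((s + n) / n ^ 3) = sqrt ((n\<^sup>2)\<^sup>2 * ((s + n) / n ^ 3))"
      by (simp only: real_sqrt_mult real_sqrt_abs abs_power2)
    also have "(n\<^sup>2)\<^sup>2 * ((s + n) / n ^ 3) = n * (s + n)"
      using n by (simp add: field_simps power2_eq_square power3_eq_cube)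
    finally show ?thesis by (simp add: y_def)
  qed
  finally have "x \<le> 7 * sqrt ((s + n) / n ^ 3)"
    using n by (simp add: mult.left_commute[of 7])
  moreover have "0 \<le> sqrt ((s + n) / n ^ 3)" using n s by simp
  ultimately have le: "x \<le> 12 * sqrt ((s + n) / n ^ 3)" by linarith
  have "x \<le> 24 * sqrt (m / n)" if "1 / n \<le> m"
  proof -
    have "n \<le> n\<^sup>2 * m"
      using mult_left_mono[OF that, of "n\<^sup>2"] n by (simp add: power2_eq_square)
    \<comment> \<open>Both \<open>s\<close> and \<open>n\<close> are at most
      \<open>n\<^sup>2 * m\<close>, so 2 would do; 4 has an integer root, which doubles 12 to
      24.\<close>
    then have "s + n \<le> 4 * n\<^sup>2 * m"
      using entry_norm1_le_entry_norm_inf[of \<Theta>] n by (simp add: s_def n_def m_def)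
    then have "(s + n) / n ^ 3 \<le> 4 * n\<^sup>2 * m / n ^ 3"
      using n by (intro divide_right_mono) auto
    also have "\<dots> = 4 * (m / n)"
      using n by (simp add: power2_eq_square power3_eq_cube)
    finally have "(s + n) / n ^ 3 \<le> 4 * (m / n)" .
    then have "sqrt ((s + n) / n ^ 3) \<le> sqrt (4 * (m / n))" by (rule real_sqrt_le_mono)
    also have "\<dots> = 2 * sqrt (m / n)" by (simp add: real_sqrt_mult real_sqrt_divide)
    finally show ?thesis using le by linarith
  qed
  with le show ?thesis by (simp add: x_def n_def s_def m_def)
qed

end
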